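(* Let $s\ge3$ and $h$ be positive integers with $s\mid h$, and let $q=2^h$. Let $\mathbb{F}_{2^s}=\{\alpha_1,\dots,\alpha_{2^s}\}$ be the subfield of $\mathbb{F}_q$ with $2^s$ elements, and let $\eta_{11},\eta_{12},\eta_{21},\eta_{22}\in\mathbb{F}_q$ satisfy $\eta_{11}\eta_{22}=\eta_{12}\eta_{21}$. Let $\boldsymbol{\alpha}=(\alpha_1,\dots,\alpha_{2^s})$ and $\boldsymbol{v}=(v_1,\dots,v_{2^s})$ with $v_i=\prod_{j=1,j\ne i}^{2^s}(\alpha_i-\alpha_j)^{-2^{h-1}}$ for $1\le i\le 2^s$. Set $$\mathcal{S}_1=\Big\{\sum_{i=0}^{2^{s-1}-2}f_ix^i+\sum_{i=1}^2f_{2^{s-1}-4+i}\sum_{j=1}^2\eta_{ij}x^{2^{s-1}-2+j}: f_i\in\mathbb{F}_q\text{ for }0\le i\le 2^{s-1}-2\Big\}.$$ Then $\mathcal{C}_1=ev_{\boldsymbol{\alpha},\boldsymbol{v}}(\mathcal{S}_1)$ is a $[2^s,\,2^{s-1}-1,\,\ge 2^{s-1}]$ self-orthogonal TGRS code over $\mathbb{F}_q$.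
   Context: For $\boldsymbol{\alpha}\in\mathbb{F}^n$ with distinct entries and $\boldsymbol{v}\in(\mathbb{F}^* )^n$ ($\mathbb{F}$ a finite field), $ev_{\boldsymbol{\alpha},\boldsymbol{v}}(f)=(v_1f(\alpha_1),\dots,v_nf(\alpha_n))$ for $f\in\mathbb{F}[x]$. For a $k\times(n-k)$ matrix $(\eta_{ij})$ over $\mathbb{F}$, the twisted generalized Reed-Solomon (TGRS) code is the image under $ev_{\boldsymbol{\alpha},\boldsymbol{v}}$ of $\{\sum_{i=0}^{k-1}f_ix^i+\sum_{i=0}^{k-1}f_i\sum_{j=1}^{n-k}\eta_{i+1,j}x^{k-1+j}:f_i\in\mathbb{F}\}$. A linear code is $[n,k,\ge d]$ if it has length $n$, dimension $k$ and minimum Hamming distance at least $d$. It is self-orthogonal if $\mathcal{C}\subseteq\mathcal{C}^\perp$ for the Euclidean inner product. *)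

theory Defs
  imports
    "HOL-Analysis.Cartesian_Space"
    "HOL-Computational_Algebra.Polynomial"
    "HOL-Computational_Algebra.Primes"
begin

definition is_subfield :: "'a::field set \<Rightarrow> bool" where
  "is_subfield K \<longleftrightarrow>
     0 \<in> K \<and> 1 \<in> K \<and>
     (\<forall>x\<in>K. \<forall>y\<in>K. x - y \<in> K) \<and>
     (\<forall>x\<in>K. \<forall>y\<in>K. x * y \<in> K) \<and>
     (\<forall>x\<in>K. inverse x \<in> K)"

definition hamming_dist :: "'a ^ 'n \<Rightarrow> 'a ^ 'n \<Rightarrow> nat" where
  "hamming_dist x y = card {i. x $ i \<noteq> y $ i}"

(* Unspecified for codes with fewer than two words. *)
definition min_dist :: "('a ^ 'n) set \<Rightarrow> nat" where
  "min_dist C = Min {hamming_dist x y | x y. x \<in> C \<and> y \<in> C \<and> x \<noteq> y}"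

(* C is an [n, k, \<ge> d] linear code; the coordinates are indexed by the type 'n. *)
definition linear_code_params :: "nat \<Rightarrow> nat \<Rightarrow> nat \<Rightarrow> ('a::finite_field ^ 'n) set \<Rightarrow> bool" where
  "linear_code_params n k d C \<longleftrightarrow>
     vec.subspace C \<and> CARD('n) = n \<and> vec.dim C = k \<and> d \<le> min_dist C"

definition dual_code :: "('a::finite_field ^ 'n) set \<Rightarrow> ('a ^ 'n) set" where
  "dual_code C = {y. \<forall>x\<in>C. scalar_product x y = 0}"

definition self_orthogonal :: "('a::finite_field ^ 'n) set \<Rightarrow> bool" where
  "self_orthogonal C \<longleftrightarrow> C \<subseteq> dual_code C"

definition ev :: "'a::finite_field ^ 'n \<Rightarrow> 'a ^ 'n \<Rightarrow> 'a poly \<Rightarrow> 'a ^ 'n" where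
  "ev \<alpha> v f = (\<chi> i. v $ i * poly f (\<alpha> $ i))"

(* The k x m matrix \<eta> is indexed from 1; only its entries \<eta> i j with 1 \<le> i \<le> k and
   1 \<le> j \<le> m are used. *)
definition twisted_polys :: "nat \<Rightarrow> nat \<Rightarrow> (nat \<Rightarrow> nat \<Rightarrow> 'a::finite_field) \<Rightarrow> 'a poly set" where
  "twisted_polys k m \<eta> =
     {(\<Sum>i=0..k-1. monom (f i) i)
        + (\<Sum>i=0..k-1. smult (f i) (\<Sum>j=1..m. monom (\<eta> (i + 1) j) (k - 1 + j))) | f. True}"

definition is_tgrs_code ::
    "'a::finite_field ^ 'n \<Rightarrow> 'a ^ 'n \<Rightarrow> nat \<Rightarrow> ('a ^ 'n) set \<Rightarrow> bool" where
  "is_tgrs_code \<alpha> v k C \<longleftrightarrow>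
     inj (\<lambda>i. \<alpha> $ i) \<and> (\<forall>i. v $ i \<noteq> 0) \<and> 1 \<le> k \<and> k \<le> CARD('n) \<and>
     (\<exists>\<eta>. C = ev \<alpha> v ` twisted_polys k (CARD('n) - k) \<eta>)"

end

theory Submission
  imports Defs
begin

text \<open>Differences of points of a subfield \<open>K\<close> run through \<open>K - {0}\<close>, so \<open>v\<close> is a constant
  non-zero vector and the inner product of two codewords is a multiple of
  \<open>\<Sum>a\<in>K. f(a) g(a)\<close>. With \<open>N = card K = 2 m\<close> and \<open>deg (f g) \<le> N\<close>, only the coefficient of
  \<open>x ^ (N - 1)\<close> in \<open>f g\<close> can contribute. It only involves the two twisted coefficients of each
  factor, and in characteristic 2 it is a multiple of \<open>det \<eta>\<close>. Dimension and distance follow from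
  \<open>deg f \<le> m\<close>, since a non-zero \<open>f\<close> vanishes at no more than \<open>m\<close> of the \<open>2 m\<close> points.\<close>

section \<open>Power sums over a finite subfield\<close>

lemma subfield_add:
  assumes "is_subfield K" "x \<in> K" "y \<in> K"
  shows "x + y \<in> K"
proof -
  have "x - (0 - y) \<in> K"
    using assms unfolding is_subfield_def by blast
  then show ?thesis by simp
qed

text \<open>Translation by 1 permutes \<open>K\<close>, so the sum of its elements equals itself
  plus \<open>card K\<close>.\<close>

lemma subfield_of_nat_card:
  fixes K :: "'a::field set"
  assumes K: "is_subfield K" and "finite K"
  shows "of_nat (card K) = (0::'a)"
proof -
  have "bij_betw (\<lambda>x. x + 1) K K"
    by (rule bij_betw_byWitness[where f' = "\<lambda>x. x - 1"])
      (use K in \<open>auto simp: is_subfield_def intro: subfield_add[OF K]\<close>)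
  then have "(\<Sum>x\<in>K. x) = (\<Sum>x\<in>K. x + 1)"
    by (rule sum.reindex_bij_betw[symmetric])
  then show ?thesis by (simp add: sum.distrib)
qed

lemma subfield_two_eq_0:
  fixes K :: "'a::field set"
  assumes "is_subfield K" and "card K = 2 ^ s"
  shows "(2::'a) = 0"
proof -
  have "finite K" using assms(2) by (intro card_ge_0_finite) simp
  then show ?thesis using subfield_of_nat_card[OF assms(1)] assms(2) by simp
qed

lemma bij_betw_mult_subfield:
  assumes K: "is_subfield K" and b: "b \<in> K" "b \<noteq> 0"
  shows "bij_betw ((*) b) K K"
  by (rule bij_betw_byWitness[where f' = "(*) (inverse b)"])
    (use assms in \<open>auto simp: is_subfield_def mult.assoc[symmetric]\<close>)

text \<open>Substituting \<open>b * a\<close> for \<open>a\<close> permutes \<open>K\<close> and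
  multiplies the sum by \<open>b ^ e\<close>, which differs from 1.\<close>

lemma subfield_power_sum_eq_0:
  fixes K :: "'a::field set"
  assumes K: "is_subfield K" and b: "b \<in> K" "b \<noteq> 0" "b ^ e \<noteq> 1"
  shows "(\<Sum>a\<in>K. a ^ e) = 0"
proof -
  have "(\<Sum>a\<in>K. a ^ e) = (\<Sum>a\<in>K. (b * a) ^ e)"
    by (rule sum.reindex_bij_betw[OF bij_betw_mult_subfield[OF K b(1,2)], symmetric])
  also have "\<dots> = b ^ e * (\<Sum>a\<in>K. a ^ e)"
    by (simp add: power_mult_distrib sum_distrib_left)
  finally show ?thesis using b(3) by (metis mult_cancel_right2)
qed

text \<open>For \<open>e > 0\<close> the polynomial \<open>x ^ e - 1\<close> has at most
  \<open>e\<close> roots, too few to cover \<open>K - {0}\<close>, so a suitable multiplier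
  \<open>b\<close> exists. For \<open>e = 0\<close> that polynomial is zero, and the sum is the
  cardinality of \<open>K\<close> instead.\<close>

lemma subfield_power_sum_less:
  fixes K :: "'a::field set"
  assumes K: "is_subfield K" and fin: "finite K" and e: "e < card K - 1"
  shows "(\<Sum>a\<in>K. a ^ e) = 0"
proof (cases "e = 0")
  case True
  then show ?thesis using subfield_of_nat_card[OF K fin] by simp
next
  case False
  define p where "p = monom (1::'a) e - 1"
  have "coeff p e = 1" using False by (simp add: p_def)
  then have p0: "p \<noteq> 0" by auto
  have "card {x. poly p x = 0} \<le> degree p"
    by (rule card_poly_roots_bound[OF p0])
  also have "degree p \<le> e"
    unfolding p_def by (intro degree_diff_le degree_monom_le) simp
  also have "\<dots> < card (K - {0})"
    using e fin K by (simp add: is_subfield_def)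
  finally have "\<not> K - {0} \<subseteq> {x. poly p x = 0}"
    using card_mono[OF poly_roots_finite[OF p0]] by (meson not_less)
  then obtain b where "b \<in> K" "b \<noteq> 0" "b ^ e \<noteq> 1"
    by (auto simp: p_def poly_monom)
  then show ?thesis by (rule subfield_power_sum_eq_0[OF K])
qed

lemma sum_power2_char_2:
  fixes f :: "'b \<Rightarrow> 'a::comm_ring_1"
  assumes "(2::'a) = 0"
  shows "(\<Sum>x\<in>A. f x ^ 2) = (\<Sum>x\<in>A. f x) ^ 2"
  by (induction A rule: infinite_finite_induct) (simp_all add: power2_sum assms)

lemma subfield_sum_poly:
  fixes K :: "'a::field set"
  assumes K: "is_subfield K" and card: "card K = 2 * m" and m: "m \<ge> 2"
    and two: "(2::'a) = 0" and deg: "degree p \<le> 2 * m" and c: "coeff p (2 * m - 1) = 0"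
  shows "(\<Sum>a\<in>K. poly p a) = 0"
proof -
  have fin: "finite K" using card m by (intro card_ge_0_finite) simp
  have poly: "poly p a = (\<Sum>i\<le>2*m. coeff p i * a ^ i)" for a
    using arg_cong[OF poly_as_sum_of_monoms'[OF deg], of "\<lambda>p. poly p a"]
    by (simp add: poly_sum poly_monom)
  have "(\<Sum>a\<in>K. poly p a) = (\<Sum>a\<in>K. \<Sum>i\<le>2*m. coeff p i * a ^ i)"
    by (simp only: poly)
  also have "\<dots> = (\<Sum>i\<le>2*m. coeff p i * (\<Sum>a\<in>K. a ^ i))"
    by (subst sum.swap) (simp add: sum_distrib_left)
  also have "\<dots> = 0"
  proof (rule sum.neutral, intro ballI)
    fix i assume "i \<in> {..2*m}"
    then consider "i < 2 * m - 1" | "i = 2 * m - 1" | "i = 2 * m" by force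
    then show "coeff p i * (\<Sum>a\<in>K. a ^ i) = 0"
    proof cases
      case 1
      then show ?thesis using subfield_power_sum_less[OF K fin, of i] card by simp
    next
      case 2
      then show ?thesis using c by simp
    next
      case 3
      \<comment> \<open>The exponent \<open>2 * m\<close> is beyond the reach of
        \<open>subfield_power_sum_less\<close>. Since squaring is additive in characteristic 2, it
        reduces to the exponent \<open>m\<close>, which is below \<open>2 * m - 1\<close> because
        \<open>m \<ge> 2\<close>.\<close>
      have "(\<Sum>a\<in>K. a ^ i) = (\<Sum>a\<in>K. (a ^ m) ^ 2)"
        by (simp add: 3 power_mult[symmetric] mult.commute)
      also have "\<dots> = (\<Sum>a\<in>K. a ^ m) ^ 2"
        by (rule sum_power2_char_2[OF two])
      also have "\<dots> = 0"
        using subfield_power_sum_less[OF K fin, of m] card m by simp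
      finally show ?thesis by simp
    qed
  qed
  finally show ?thesis .
qed

text \<open>Of two exponents with sum \<open>2 * m - 1\<close>, one exceeds \<open>m\<close> unless
  they are \<open>m - 1\<close> and \<open>m\<close>.\<close>

lemma coeff_mult_degree_bound:
  fixes p q :: "'a::comm_ring_1 poly"
  assumes "degree p \<le> m" "degree q \<le> m" "m \<ge> 1"
  shows "coeff (p * q) (2 * m - 1)
    = coeff p (m - 1) * coeff q m + coeff p m * coeff q (m - 1)"
proof -
  have "coeff (p * q) (2 * m - 1) = (\<Sum>i\<le>2*m-1. coeff p i * coeff q (2*m-1-i))"
    by (simp add: coeff_mult)
  also have "\<dots> = (\<Sum>i\<in>{m - 1, m}. coeff p i * coeff q (2*m-1-i))"
  proof (rule sum.mono_neutral_right)
    show "\<forall>i\<in>{..2*m-1} - {m - 1, m}. coeff p i * coeff q (2*m-1-i) = 0"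
    proof
      fix i assume "i \<in> {..2*m-1} - {m - 1, m}"
      then have "i > m \<or> 2*m-1-i > m" by auto
      then show "coeff p i * coeff q (2*m-1-i) = 0"
        using assms(1,2) by (metis coeff_eq_0 le_less_trans mult_zero_left mult_zero_right)
    qed
  qed (use assms(3) in auto)
  also have "\<dots> = coeff p (m - 1) * coeff q m + coeff p m * coeff q (m - 1)"
  proof -
    have "2 * m - 1 - (m - 1) = m" "2 * m - 1 - m = m - 1" "m - 1 \<noteq> m"
      using assms(3) by auto
    then show ?thesis by simp
  qed
  finally show ?thesis .
qed

section \<open>Evaluation codes\<close>

lemma ev_add: "ev \<alpha> v (p + q) = ev \<alpha> v p + ev \<alpha> v q"
  and ev_smult: "ev \<alpha> v (smult c p) = c *s ev \<alpha> v p"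
  and ev_0: "ev \<alpha> v 0 = 0"
  by (simp_all add: ev_def vec_eq_iff algebra_simps)

lemma ev_sum: "ev \<alpha> v (\<Sum>i\<in>A. f i) = (\<Sum>i\<in>A. ev \<alpha> v (f i))"
  by (induction A rule: infinite_finite_induct) (simp_all add: ev_0 ev_add)

text \<open>The zero positions of the word inject into the roots of \<open>p\<close>, of which there
  are at most \<open>degree p\<close>.\<close>

lemma ev_weight:
  fixes \<alpha> v :: "'a::finite_field ^ 'n"
  assumes inj: "inj (\<lambda>i. \<alpha> $ i)" and v: "\<And>i. v $ i \<noteq> 0" and "p \<noteq> 0"
  shows "CARD('n) - degree p \<le> card {i. ev \<alpha> v p $ i \<noteq> 0}"
proof -
  let ?Z = "{i. poly p (\<alpha> $ i) = 0}"
  have "card ?Z = card ((\<lambda>i. \<alpha> $ i) ` ?Z)"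
    by (rule card_image[symmetric]) (use inj in \<open>simp add: inj_on_def\<close>)
  also have "\<dots> \<le> card {x. poly p x = 0}"
    by (intro card_mono poly_roots_finite[OF \<open>p \<noteq> 0\<close>]) auto
  also have "\<dots> \<le> degree p"
    by (rule card_poly_roots_bound[OF \<open>p \<noteq> 0\<close>])
  finally have "card ?Z \<le> degree p" .
  moreover have "{i. ev \<alpha> v p $ i \<noteq> 0} = UNIV - ?Z"
    using v by (auto simp: ev_def)
  ultimately show ?thesis by (simp add: card_Diff_subset)
qed

lemma ev_eq_0_iff:
  fixes \<alpha> v :: "'a::finite_field ^ 'n"
  assumes "inj (\<lambda>i. \<alpha> $ i)" "\<And>i. v $ i \<noteq> 0" "degree p < CARD('n)"
  shows "ev \<alpha> v p = 0 \<longleftrightarrow> p = 0"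
proof
  assume "ev \<alpha> v p = 0"
  then have "card {i. ev \<alpha> v p $ i \<noteq> 0} = 0" by simp
  with ev_weight[OF assms(1,2), of p] assms(3) show "p = 0" by (cases "p = 0") simp_all
qed (simp add: ev_0)

text \<open>By linearity, distances between codewords are weights of codewords. A non-zero word
  makes the set of distances non-empty, so that its \<open>Min\<close> is attained.\<close>

lemma min_dist_ge:
  fixes C :: "('a::finite_field ^ 'n) set"
  assumes sub: "vec.subspace C" and "C \<noteq> {0}"
    and weight: "\<And>x. x \<in> C \<Longrightarrow> x \<noteq> 0 \<Longrightarrow> d \<le> card {i. x $ i \<noteq> 0}"
  shows "d \<le> min_dist C"
proof -
  let ?D = "{hamming_dist x y | x y. x \<in> C \<and> y \<in> C \<and> x \<noteq> y}"
  have "?D \<subseteq> {..CARD('n)}" by (auto simp: hamming_dist_def card_mono)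
  then have fin: "finite ?D" by (rule finite_subset) simp
  have "0 \<in> C" using sub by (rule vec.subspace_0)
  with \<open>C \<noteq> {0}\<close> have "?D \<noteq> {}" by blast
  then have "min_dist C \<in> ?D"
    unfolding min_dist_def by (rule Min_in[OF fin])
  then obtain x y where "x \<in> C" "y \<in> C" "x \<noteq> y" "min_dist C = hamming_dist x y" by blast
  moreover from this have "d \<le> card {i. (x - y) $ i \<noteq> 0}"
    by (intro weight vec.subspace_diff[OF sub]) auto
  ultimately show ?thesis by (simp add: hamming_dist_def)
qed

section \<open>Twisted generalized Reed-Solomon codes\<close>

text \<open>These are the generators of the twisted polynomial space. The index \<open>i\<close>
  starts at 0 but the rows of \<eta> start at 1, hence \<open>i + 1\<close>.\<close>

definition twisted_basis :: "nat \<Rightarrow> nat \<Rightarrow> (nat \<Rightarrow> nat \<Rightarrow> 'a::finite_field) \<Rightarrow> nat \<Rightarrow> 'a poly" where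
  "twisted_basis k m \<eta> i = monom 1 i + (\<Sum>j=1..m. monom (\<eta> (i + 1) j) (k - 1 + j))"

lemma twisted_polys_eq:
  assumes "k \<ge> 1"
  shows "twisted_polys k m \<eta> = range (\<lambda>f. \<Sum>i<k. smult (f i) (twisted_basis k m \<eta> i))"
proof -
  have "{0..k-1} = {..<k}" using assms by auto
  then show ?thesis
    unfolding twisted_polys_def twisted_basis_def
    by (auto simp: smult_add_right sum.distrib smult_monom)
qed

text \<open>All twist monomials have degree at least \<open>k\<close>, so the scalars can be read
  off below degree \<open>k\<close>. This yields linear independence.\<close>

lemma coeff_twisted_comb:
  assumes "l < k"
  shows "coeff (\<Sum>i<k. smult (f i) (twisted_basis k m \<eta> i)) l = f l"
proof -
  have basis: "coeff (twisted_basis k m \<eta> i) l = (if i = l then 1 else 0)" for i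
  proof -
    have "(\<Sum>j=1..m. coeff (monom (\<eta> (i + 1) j) (k - 1 + j)) l) = 0"
      by (rule sum.neutral) (use assms in auto)
    then show ?thesis by (simp add: twisted_basis_def coeff_sum)
  qed
  show ?thesis using assms by (simp add: coeff_sum basis if_distrib cong: if_cong)
qed

lemma degree_twisted_basis:
  assumes "i < k"
  shows "degree (twisted_basis k m \<eta> i) \<le> k - 1 + m"
  unfolding twisted_basis_def
  by (intro degree_add_le degree_sum_le order.trans[OF degree_monom_le]) (use assms in auto)

lemma degree_twisted_comb:
  "degree (\<Sum>i<k. smult (f i) (twisted_basis k m \<eta> i)) \<le> k - 1 + m"
  by (intro degree_sum_le order.trans[OF degree_smult_le] degree_twisted_basis) auto

text \<open>All polynomials involved have degree below the length, so evaluation is injective on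
  them and the images of the \<open>k\<close> generators form a basis.\<close>

lemma ev_twisted_polys:
  fixes \<alpha> v :: "'a::finite_field ^ 'n"
  assumes k: "k \<ge> 1" and km: "k + m \<le> CARD('n)"
    and inj: "inj (\<lambda>i. \<alpha> $ i)" and v: "\<And>i. v $ i \<noteq> 0"
  shows "vec.subspace (ev \<alpha> v ` twisted_polys k m \<eta>)"
    and "vec.dim (ev \<alpha> v ` twisted_polys k m \<eta>) = k"
proof -
  let ?P = "\<lambda>f. \<Sum>i<k. smult (f i) (twisted_basis k m \<eta> i)"
  define b where "b i = ev \<alpha> v (twisted_basis k m \<eta> i)" for i
  have ev_P: "ev \<alpha> v (?P f) = (\<Sum>i<k. f i *s b i)" for f
    by (simp add: ev_sum ev_smult b_def)
  have zero: "f i = 0" if "(\<Sum>i<k. f i *s b i) = 0" "i < k" for f i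
  proof -
    have "degree (?P f) < CARD('n)"
      using degree_twisted_comb[of f k m \<eta>] k km by linarith
    then have "?P f = 0"
      using ev_eq_0_iff[OF inj v] that(1) ev_P by metis
    then show ?thesis using coeff_twisted_comb[OF that(2), of f m \<eta>] by simp
  qed
  have inj_b: "inj_on b {..<k}"
  proof (rule inj_onI)
    fix i j assume ij: "i \<in> {..<k}" "j \<in> {..<k}" "b i = b j"
    show "i = j"
    proof (rule ccontr)
      assume "i \<noteq> j"
      have single: "(\<Sum>l<k. (if l = t then 1 else 0) *s b l) = b t" if "t < k" for t
        using that by (simp add: if_distrib[of "\<lambda>c. c *s _"] cong: if_cong)
      \<comment> \<open>If \<open>b i = b j\<close>, the scalars 1 at \<open>i\<close> and -1 at
        \<open>j\<close> give a non-trivial vanishing combination.\<close>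
      have "(\<Sum>l<k. ((if l = i then 1 else 0) - (if l = j then 1 else 0)) *s b l) = 0"
        using ij single by (simp add: vec.scale_left_diff_distrib sum_subtractf)
      from zero[OF this, of i] ij \<open>i \<noteq> j\<close> show False by simp
    qed
  qed
  have C: "ev \<alpha> v ` twisted_polys k m \<eta> = range (\<lambda>f. \<Sum>i<k. f i *s b i)"
    unfolding twisted_polys_eq[OF k] image_image ev_P ..
  have span: "vec.span (b ` {..<k}) = ev \<alpha> v ` twisted_polys k m \<eta>"
  proof -
    have "range (\<lambda>f. \<Sum>i<k. f i *s b i) = range (\<lambda>u. \<Sum>i<k. u (b i) *s b i)"
    proof (intro equalityI subsetI)
      fix x assume "x \<in> range (\<lambda>f. \<Sum>i<k. f i *s b i)"
      then obtain f where "x = (\<Sum>i<k. f i *s b i)" by blast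
      \<comment> \<open>\<open>vec.span_finite\<close> indexes scalars by vectors; the inverse of
        \<open>b\<close> converts from indices.\<close>
      then have "x = (\<Sum>i<k. f (the_inv_into {..<k} b (b i)) *s b i)"
        by (simp add: the_inv_into_f_f[OF inj_b])
      then show "x \<in> range (\<lambda>u. \<Sum>i<k. u (b i) *s b i)"
        by (intro image_eqI[where x = "\<lambda>y. f (the_inv_into {..<k} b y)"]) auto
    qed auto
    then show ?thesis
      by (simp add: C vec.span_finite sum.reindex[OF inj_b])
  qed
  then show "vec.subspace (ev \<alpha> v ` twisted_polys k m \<eta>)"
    by (metis vec.subspace_span)
  have "vec.independent (b ` {..<k})"
  proof (rule vec.independent_if_scalars_zero)
    fix u x assume "(\<Sum>x\<in>b ` {..<k}. u x *s x) = 0" "x \<in> b ` {..<k}"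
    then show "u x = 0"
      using zero[of "\<lambda>i. u (b i)"] by (auto simp: sum.reindex[OF inj_b])
  qed simp
  then have "vec.dim (vec.span (b ` {..<k})) = card (b ` {..<k})"
    by (simp add: vec.dim_eq_card_independent)
  then show "vec.dim (ev \<alpha> v ` twisted_polys k m \<eta>) = k"
    by (simp add: span card_image[OF inj_b])
qed

text \<open>Reflection of \<open>K\<close> at the point with index \<open>i\<close> maps the
  remaining points bijectively onto \<open>K - {0}\<close>, so the product is the same for every
  \<open>i\<close>.\<close>

lemma prod_diff_subfield:
  fixes \<alpha> :: "'a::finite_field ^ 'n"
  assumes K: "is_subfield K" and bij: "bij_betw (\<lambda>i. \<alpha> $ i) UNIV K"
  shows "(\<Prod>j\<in>UNIV - {i}. f (\<alpha> $ i - \<alpha> $ j)) = (\<Prod>a\<in>K - {0}. f a)"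
proof -
  let ?a = "\<alpha> $ i"
  have a: "?a \<in> K" using bij by (auto simp: bij_betw_def)
  have "bij_betw (\<lambda>x. ?a - x) (K - {?a}) (K - {0})"
    by (rule bij_betw_byWitness[where f' = "\<lambda>x. ?a - x"])
      (use K a in \<open>auto simp: is_subfield_def\<close>)
  moreover have "bij_betw (\<lambda>j. \<alpha> $ j) (UNIV - {i}) (K - {?a})"
    using bij by (auto simp: bij_betw_def inj_on_def)
  ultimately have "bij_betw ((\<lambda>x. ?a - x) \<circ> (\<lambda>j. \<alpha> $ j)) (UNIV - {i}) (K - {0})"
    by (metis bij_betw_trans)
  from prod.reindex_bij_betw[OF this, of f] show ?thesis by simp
qed

theorem theorem14:
  fixes s h :: nat
    and K :: "'a::finite_field set"
    and \<eta> :: "nat \<Rightarrow> nat \<Rightarrow> 'a"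
    and \<alpha> v :: "'a ^ 'n"
    and S :: "'a poly set"
  assumes "s \<ge> 3" and "h > 0" and "s dvd h"
    and "CARD('a) = 2 ^ h"
    and "is_subfield K" and "card K = 2 ^ s"
    and "CARD('n) = 2 ^ s" and "bij_betw (\<lambda>i. \<alpha> $ i) UNIV K"
    and "\<eta> 1 1 * \<eta> 2 2 = \<eta> 1 2 * \<eta> 2 1"
    and "\<And>i. v $ i = (\<Prod>j\<in>UNIV - {i}. (\<alpha> $ i - \<alpha> $ j) powi (- (2 ^ (h - 1))))"
    and "S = {(\<Sum>i=0..2^(s-1)-2. monom (f i) i)
              + (\<Sum>i=1..2. smult (f (2^(s-1) - 4 + i)) (\<Sum>j=1..2. monom (\<eta> i j) (2^(s-1) - 2 + j)))
            | f. True}"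
  shows "linear_code_params (2 ^ s) (2 ^ (s - 1) - 1) (2 ^ (s - 1)) (ev \<alpha> v ` S)
       \<and> self_orthogonal (ev \<alpha> v ` S)
       \<and> is_tgrs_code \<alpha> v (2 ^ (s - 1) - 1) (ev \<alpha> v ` S)"
proof -
  define m :: nat where "m = 2 ^ (s - 1)"
  define k where "k = m - 1"
  \<comment> \<open>The bound \<open>m \<ge> 4\<close> ensures that the natural-number subtraction
    in \<open>m - 4 + i\<close> does not truncate.\<close>
  have "(2::nat) ^ 2 \<le> 2 ^ (s - 1)" by (rule power_increasing) (use assms(1) in auto)
  then have m: "m \<ge> 4" by (simp add: m_def)
  have N: "(2::nat) ^ s = 2 * m" using assms(1) by (simp add: m_def flip: power_Suc)
  note K = \<open>is_subfield K\<close> and bij = \<open>bij_betw (\<lambda>i. \<alpha> $ i) UNIV K\<close>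
  have two: "(2::'a) = 0" by (rule subfield_two_eq_0[OF K assms(6)])
  have inj: "inj (\<lambda>i. \<alpha> $ i)" using bij by (simp add: bij_betw_def)

  define c where "c = (\<Prod>a\<in>K - {0}. a powi (- (2 ^ (h - 1))))"
  have v: "v $ i = c" for i
    unfolding assms(10) c_def by (rule prod_diff_subfield[OF K bij])
  have "c \<noteq> 0" unfolding c_def by (subst prod_zero_iff) auto
  with v have v0: "v $ i \<noteq> 0" for i by simp

  define P where "P f = (\<Sum>i=0..m-2. monom (f i) i)
    + (\<Sum>i=1..2. smult (f (m - 4 + i)) (\<Sum>j=1..2. monom (\<eta> i j) (m - 2 + j)))" for f
  have S: "S = range P"
    unfolding assms(11) P_def m_def by blast
  have P_eq: "P f = (\<Sum>i=0..m-2. monom (f i) i)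
    + (smult (f (m - 3)) (monom (\<eta> 1 1) (m - 1) + monom (\<eta> 1 2) m)
      + smult (f (m - 2)) (monom (\<eta> 2 1) (m - 1) + monom (\<eta> 2 2) m))" for f
  proof -
    have "{1..2::nat} = {1, 2}" by auto
    moreover have "m - 4 + 1 = m - 3" "m - 4 + 2 = m - 2" "m - 2 + 1 = m - 1" "m - 2 + 2 = m"
      using m by auto
    ultimately show ?thesis unfolding P_def by simp
  qed
  have deg_P: "degree (P f) \<le> m" for f
    unfolding P_eq
    by (intro degree_add_le degree_sum_le order.trans[OF degree_monom_le]
        order.trans[OF degree_smult_le]) (use m in auto)
  \<comment> \<open>The untwisted monomials stop at degree \<open>m - 2\<close>, so only the twists
    reach degrees \<open>m - 1\<close> and \<open>m\<close>.\<close>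
  have coeff_P: "coeff (P f) (m - 1) = f (m - 3) * \<eta> 1 1 + f (m - 2) * \<eta> 2 1"
    "coeff (P f) m = f (m - 3) * \<eta> 1 2 + f (m - 2) * \<eta> 2 2" for f
    using m by (auto simp: P_eq coeff_sum intro!: sum.neutral)

  \<comment> \<open>The given 2 x 2 matrix is placed in the first two columns of the last two rows,
    \<open>k = m - 1\<close> and \<open>k - 1\<close>, of a matrix that is zero elsewhere.\<close>
  define \<eta>' where "\<eta>' i j = (if i + 1 = m \<and> j \<le> 2 then \<eta> 2 j
    else if i + 2 = m \<and> j \<le> 2 then \<eta> 1 j else 0)" for i j
  have S_twisted: "S = twisted_polys k (CARD('n) - k) \<eta>'"
  proof -
    have "(\<Sum>i=0..k-1. smult (f i) (\<Sum>j=1..CARD('n)-k. monom (\<eta>' (i + 1) j) (k - 1 + j)))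
      = smult (f (m - 3)) (monom (\<eta> 1 1) (m - 1) + monom (\<eta> 1 2) m)
        + smult (f (m - 2)) (monom (\<eta> 2 1) (m - 1) + monom (\<eta> 2 2) m)" for f
    proof -
      have inner: "(\<Sum>j=1..CARD('n)-k. monom (\<eta>' (i + 1) j) (k - 1 + j))
        = monom (\<eta>' (i + 1) 1) (m - 1) + monom (\<eta>' (i + 1) 2) m" for i
      proof -
        have "(\<Sum>j=1..CARD('n)-k. monom (\<eta>' (i + 1) j) (k - 1 + j))
          = (\<Sum>j\<in>{1, 2}. monom (\<eta>' (i + 1) j) (k - 1 + j))"
          by (rule sum.mono_neutral_right)
            (use m assms(7) N in \<open>auto simp: k_def \<eta>'_def\<close>)
        also have "k - 1 + 1 = m - 1" "k - 1 + 2 = m" using m by (auto simp: k_def)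
        then have "(\<Sum>j\<in>{1, 2}. monom (\<eta>' (i + 1) j) (k - 1 + j))
          = monom (\<eta>' (i + 1) 1) (m - 1) + monom (\<eta>' (i + 1) 2) m" by simp
        finally show ?thesis .
      qed
      have "(\<Sum>i=0..k-1. smult (f i) (monom (\<eta>' (i + 1) 1) (m - 1) + monom (\<eta>' (i + 1) 2) m))
        = (\<Sum>i\<in>{m - 3, m - 2}. smult (f i) (monom (\<eta>' (i + 1) 1) (m - 1) + monom (\<eta>' (i + 1) 2) m))"
        by (rule sum.mono_neutral_right) (use m in \<open>auto simp: k_def \<eta>'_def\<close>)
      moreover have "m - 3 \<noteq> m - 2"
        using m by auto
      moreover have "\<eta>' (m - 3 + 1) j = \<eta> 1 j" "\<eta>' (m - 2 + 1) j = \<eta> 2 j" if "j \<le> 2" for j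
        using m that by (auto simp: \<eta>'_def)
      ultimately show ?thesis unfolding inner by simp
    qed
    moreover have "k - 1 = m - 2" by (simp add: k_def)
    ultimately have "twisted_polys k (CARD('n) - k) \<eta>' = range P"
      unfolding twisted_polys_def P_eq by auto
    with S show ?thesis by simp
  qed

  have k: "k \<ge> 1" "k + (CARD('n) - k) \<le> CARD('n)" "k \<le> CARD('n)"
    using m assms(7) N by (auto simp: k_def)
  note sub = ev_twisted_polys[OF k(1,2) inj v0, of \<eta>', folded S_twisted]

  have "m \<le> min_dist (ev \<alpha> v ` S)"
  proof (rule min_dist_ge[OF sub(1)])
    \<comment> \<open>The dimension \<open>k\<close> is positive, so the code is not
      trivial.\<close>
    show "ev \<alpha> v ` S \<noteq> {0}"
    proof
      assume "ev \<alpha> v ` S = {0}"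
      then have "vec.dim (ev \<alpha> v ` S) = 0" by (simp add: vec.dim_eq_0)
      then show False using sub(2) k(1) by simp
    qed
  next
    fix x assume "x \<in> ev \<alpha> v ` S" "x \<noteq> 0"
    then obtain f where x: "x = ev \<alpha> v (P f)" and "P f \<noteq> 0"
      unfolding S using ev_0 by fastforce
    \<comment> \<open>The length is \<open>2 * m\<close> and the degree at most \<open>m\<close>,
      which leaves weight at least \<open>m\<close>.\<close>
    from ev_weight[OF inj v0 this(2)] deg_P[of f] assms(7) N
    show "m \<le> card {i. x $ i \<noteq> 0}" unfolding x by linarith
  qed
  then have params: "linear_code_params (2 ^ s) k m (ev \<alpha> v ` S)"
    unfolding linear_code_params_def using sub assms(7) by simp

  \<comment> \<open>In characteristic 2 the vanishing determinant may be written with a plus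
    sign.\<close>
  have det: "\<eta> 1 1 * \<eta> 2 2 + \<eta> 1 2 * \<eta> 2 1 = 0"
    by (simp only: assms(9) mult_2[symmetric] two mult_zero_left)
  have "scalar_product (ev \<alpha> v (P f)) (ev \<alpha> v (P g)) = 0" for f g
  proof -
    have "coeff (P f * P g) (2 * m - 1)
      = coeff (P f) (m - 1) * coeff (P g) m + coeff (P f) m * coeff (P g) (m - 1)"
      using m by (intro coeff_mult_degree_bound deg_P) simp
    \<comment> \<open>Terms using a single row of \<eta> occur twice and cancel in characteristic 2;
      the mixed terms collect into the determinant.\<close>
    also have "\<dots> = 2 * (f (m - 3) * g (m - 3) * \<eta> 1 1 * \<eta> 1 2
        + f (m - 2) * g (m - 2) * \<eta> 2 1 * \<eta> 2 2)
      + (f (m - 3) * g (m - 2) + f (m - 2) * g (m - 3)) * (\<eta> 1 1 * \<eta> 2 2 + \<eta> 1 2 * \<eta> 2 1)"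
      unfolding coeff_P by (simp add: algebra_simps)
    also have "\<dots> = 0"
      by (simp only: two det mult_zero_left mult_zero_right add_0)
    finally have coeff0: "coeff (P f * P g) (2 * m - 1) = 0" .
    have "degree (P f * P g) \<le> 2 * m"
      using degree_mult_le[of "P f" "P g"] deg_P[of f] deg_P[of g] by linarith
    then have "(\<Sum>a\<in>K. poly (P f * P g) a) = 0"
      using coeff0 m assms(6) N by (intro subfield_sum_poly[OF K _ _ two]) auto
    then have "(\<Sum>i\<in>UNIV. poly (P f * P g) (\<alpha> $ i)) = 0"
      using sum.reindex_bij_betw[OF bij, of "poly (P f * P g)"] by simp
    \<comment> \<open>As \<open>v\<close> is constantly \<open>c\<close>, each coordinate
      contributes the same factor \<open>c\<^sup>2\<close>.\<close>
    moreover have "scalar_product (ev \<alpha> v (P f)) (ev \<alpha> v (P g))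
      = c\<^sup>2 * (\<Sum>i\<in>UNIV. poly (P f * P g) (\<alpha> $ i))"
      by (simp add: scalar_product_def ev_def v sum_distrib_left power2_eq_square algebra_simps)
    ultimately show ?thesis by simp
  qed
  then have "self_orthogonal (ev \<alpha> v ` S)"
    unfolding self_orthogonal_def dual_code_def S by auto
  moreover have "is_tgrs_code \<alpha> v k (ev \<alpha> v ` S)"
    unfolding is_tgrs_code_def using inj v0 k S_twisted by blast
  ultimately show ?thesis using params by (simp add: k_def m_def)
qed

end
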